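(* There exists a constant $c>0$ such that for every sufficiently large integer $n$ there exist at least $2^{cn}$ symmetric complete sum-free subsets of $\mathbb{Z}_n$.
   Context: $\mathbb{Z}_n$ is the cyclic group of integers modulo $n$. For a subset $S$ of an abelian additive group $G$, $S+S=\{x+y \mid x,y\in S\}$. The set $S$ is symmetric if $x\in S$ implies $-x\in S$, complete if every $z\in G\setminus S$ satisfies $z\in S+S$, and sum-free if $S\cap(S+S)=\emptyset$. *)

theory Defs
  imports Complex_Main "HOL-Algebra.Elementary_Groups"
begin

(* HOL-Algebra writes groups multiplicatively, so for a subset S of an additively
   written abelian group G the sumset S + S is S <#>\<^bsub>G\<^esub> S and -x is inv\<^bsub>G\<^esub> x. *)

definition symmetric_set :: "('a, 'b) monoid_scheme \<Rightarrow> 'a set \<Rightarrow> bool" where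
  "symmetric_set G S \<longleftrightarrow> (\<forall>x\<in>S. inv\<^bsub>G\<^esub> x \<in> S)"

definition complete_set :: "('a, 'b) monoid_scheme \<Rightarrow> 'a set \<Rightarrow> bool" where
  "complete_set G S \<longleftrightarrow> (\<forall>z \<in> carrier G - S. z \<in> S <#>\<^bsub>G\<^esub> S)"

definition sum_free_set :: "('a, 'b) monoid_scheme \<Rightarrow> 'a set \<Rightarrow> bool" where
  "sum_free_set G S \<longleftrightarrow> S \<inter> (S <#>\<^bsub>G\<^esub> S) = {}"

end

theory Submission
  imports Defs
begin

text \<open>
  A symmetric set \<open>S\<close> in \<open>\<int>\<^sub>n\<close> is sum-free and complete iff no three of its elements sum to \<open>0\<close>
  and every \<open>z \<notin> S\<close> can be completed by two elements of \<open>S\<close> to a zero sum. The middle third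
  of \<open>\<int>\<^sub>n\<close> is nearly such a set; the many examples come from perturbing its two ends.

  Write \<open>n = 3m + r\<close> with \<open>0 \<le> r \<le> 2\<close>. Choose a set \<open>N\<close> of small positive integers with least
  element \<open>2h\<close> and greatest element \<open>b = 4h - r - 1\<close>, and let \<open>S\<close> contain the residues \<open>m - k\<close>
  for \<open>k \<in> N\<close>. As \<open>(m - k) + (m - l) + (m + r + k + l) = n\<close>, sum-freeness forbids the residues
  \<open>m + r + s\<close> with \<open>s \<in> N + N\<close>. All other residues from \<open>m + 2h\<close> up to the middle of the group
  are put into \<open>S\<close>, and the whole is made symmetric. No other zero sum can arise, for reasons
  of size: the value of \<open>b\<close> is the largest for which \<open>(m - b) + (m + 2h) + (m + 2h)\<close> still
  exceeds \<open>n\<close> (lemma \<open>no_triple_sums_to_n\<close>).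

  The forbidden residues are covered by construction. The long untouched stretch of \<open>S\<close>
  around \<open>n/2\<close> covers all small residues by differences, and together with the two extreme
  elements \<open>m - 2h\<close> and \<open>m - b\<close> it covers everything near \<open>m\<close>, with one exception:
  a residue \<open>m - x\<close> where \<open>x\<close> lies between \<open>2h\<close> and \<open>b\<close> and \<open>x \<notin> N\<close>. Completing it with
  \<open>m - 2h\<close> requires \<open>m + r + (x + 2h) \<in> S\<close>, that is \<open>x + 2h \<notin> N + N\<close>. This holds if all
  elements of \<open>N\<close> apart from \<open>2h\<close> are at least \<open>3h\<close>: a sum \<open>k + l\<close> of two of these is at
  least \<open>6h > b + 2h\<close>, whereas \<open>2h + k = x + 2h\<close> gives \<open>x = k \<in> N\<close>
  (lemma \<open>bottom_shift_pair_sums\<close>).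

  Nothing else restricts \<open>N\<close>, so each subset of \<open>{3h..4h - 4}\<close> yields an example. The set
  \<open>N\<close> can be read off from \<open>S\<close>, and \<open>h\<close> may be a fixed proportion of \<open>n\<close>. This gives
  \<open>2^(h - 3)\<close> different sets, exponentially many in \<open>n\<close>.
\<close>

section \<open>Perturbing the ends of the middle third\<close>

text \<open>
  The factor \<open>100\<close> is generous: it keeps the perturbations near \<open>n/3\<close> and near \<open>2n/3\<close> so far
  apart that they do not interact.
\<close>
locale profile =
  fixes m r h :: int and N :: "int set"
  assumes r_bounds: "0 \<le> r" "r \<le> 2"
    and scale: "3 \<le> h" "100 * h \<le> m"
    and bottom: "2 * h \<in> N"
    and top: "4 * h - r - 1 \<in> N"
    and upper: "\<And>k. k \<in> N \<Longrightarrow> k \<le> 4 * h - r - 1"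
    and gap: "\<And>k. k \<in> N \<Longrightarrow> k = 2 * h \<or> 3 * h \<le> k"
begin

definition n :: int where "n = 3 * m + r"

definition pair_sums :: "int set" where
  "pair_sums = {k + l | k l. k \<in> N \<and> l \<in> N}"

definition low :: "int set" where "low = {m - k | k. k \<in> N}"

text \<open>The two last conditions are mirror images under \<open>y \<mapsto> n - y\<close>; only one of them has any
  effect at each end of the interval.\<close>
definition mid :: "int set" where
  "mid = {y. m + 2 * h \<le> y \<and> y \<le> n - m - 2 * h \<and>
             y - m - r \<notin> pair_sums \<and> n - y - m - r \<notin> pair_sums}"

definition S :: "int set" where
  "S = low \<union> mid \<union> {n - a | a. a \<in> low}"

lemma lower: "k \<in> N \<Longrightarrow> 2 * h \<le> k"
  using gap[of k] scale by linarith

lemma pair_sums_bounds: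
  assumes "s \<in> pair_sums"
  shows "4 * h \<le> s" "s \<le> 8 * h - 2 * r - 2"
proof -
  obtain k l where "k \<in> N" "l \<in> N" "s = k + l"
    using assms unfolding pair_sums_def by auto
  then show "4 * h \<le> s" "s \<le> 8 * h - 2 * r - 2"
    using lower[of k] lower[of l] upper[of k] upper[of l] by linarith+
qed

text \<open>
  The gap between \<open>2h\<close> and \<open>3h\<close> makes a sum as small as \<open>x + 2h\<close> use the summand \<open>2h\<close>. This is
  what lets \<open>m - 2h\<close> cover every \<open>m - x\<close> left out of the set, however \<open>N\<close> is chosen.
\<close>
lemma bottom_shift_pair_sums:
  assumes "x \<le> 4 * h - r - 1" "x + 2 * h \<in> pair_sums"
  shows "x \<in> N"
proof -
  obtain k l where kl: "k \<in> N" "l \<in> N" "x + 2 * h = k + l"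
    using assms(2) unfolding pair_sums_def by auto
  have "k = 2 * h \<or> l = 2 * h"
    using gap[OF kl(1)] gap[OF kl(2)] kl(3) assms(1) r_bounds by linarith
  then show ?thesis using kl by auto
qed

lemma low_bounds:
  assumes "a \<in> low"
  shows "m - 4 * h + r + 1 \<le> a" "a \<le> m - 2 * h"
  using assms lower upper unfolding low_def by fastforce+

lemma lowI: "k \<in> N \<Longrightarrow> m - k \<in> low"
  unfolding low_def by blast

lemma mid_reflect: "y \<in> mid \<Longrightarrow> n - y \<in> mid"
  unfolding mid_def by auto

lemma S_reflect: "x \<in> S \<Longrightarrow> n - x \<in> S"
  unfolding S_def using mid_reflect by auto

lemma S_range:
  assumes "x \<in> S"
  shows "0 < x" "x < n"
proof -
  have "0 < x \<and> x < n"
    using assms low_bounds r_bounds scale unfolding S_def mid_def n_def by fastforce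
  then show "0 < x" "x < n" by auto
qed

section \<open>Sum-freeness\<close>

text \<open>
  By symmetry a solution of \<open>x + y \<equiv> w\<close> is a triple with \<open>x + y + z \<equiv> 0\<close>, and after
  reflecting all three members if necessary the integer sum is exactly \<open>n\<close>. Such a sum needs
  two elements below \<open>m\<close>, since otherwise it is too large; and the construction removes
  exactly the third elements that would then fit.
\<close>
lemma no_triple_sums_to_n:
  assumes "x \<in> S" "y \<in> S" "z \<in> S"
  shows "x + y + z \<noteq> n"
proof
  assume sum: "x + y + z = n"
  have cases: "w \<in> low \<or> m + 2 * h \<le> w" if "w \<in> S" for w
    using that low_bounds[of "n - w"] r_bounds scale
    unfolding S_def mid_def n_def by (auto dest!: low_bounds)
  have key: False if "a \<in> low" "b \<in> low" "c \<in> S" "a + b + c = n" for a b c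
  proof -
    obtain k l where kl: "k \<in> N" "l \<in> N" "a = m - k" "b = m - l"
      using \<open>a \<in> low\<close> \<open>b \<in> low\<close> unfolding low_def by auto
    have c: "c - m - r = k + l" using kl that(4) unfolding n_def by auto
    then have "c - m - r \<in> pair_sums" using kl unfolding pair_sums_def by auto
    then have "c \<notin> mid" unfolding mid_def by auto
    moreover have "c \<notin> low"
      using low_bounds[of c] c lower[OF kl(1)] lower[OF kl(2)] r_bounds scale by auto
    moreover have "n - c \<notin> low"
      using low_bounds[of "n - c"] c upper[OF kl(1)] upper[OF kl(2)] r_bounds scale
      unfolding n_def by auto
    ultimately show False using \<open>c \<in> S\<close> unfolding S_def by auto
  qed
  have low_lower: "m - 4 * h + r + 1 \<le> w" if "w \<in> S" for w
    using cases[OF that] low_bounds[of w] r_bounds scale by auto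
  have big: False if "a \<in> S" "b \<ge> m + 2 * h" "c \<ge> m + 2 * h" "a + b + c = n" for a b c
    using low_lower[OF that(1)] that unfolding n_def by linarith
  show False
    using cases[OF assms(1)] cases[OF assms(2)] cases[OF assms(3)]
      key[of x y z] key[of x z y] key[of y z x] big[of x y z] big[of y x z] big[of z x y]
      assms sum by (auto simp: add_ac)
qed

lemma sum_free:
  assumes "x \<in> S" "y \<in> S"
  shows "(x + y) mod n \<notin> S"
proof
  assume z: "(x + y) mod n \<in> S"
  show False
  proof (cases "x + y < n")
    case True
    then have "(x + y) mod n = x + y"
      using S_range[OF assms(1)] S_range[OF assms(2)] by (intro mod_pos_pos_trivial) auto
    then show False
      using no_triple_sums_to_n[OF assms S_reflect[OF z]] by auto
  next
    case False
    have "(x + y) mod n = (x + y - n) mod n" by simp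
    also have "\<dots> = x + y - n"
      using False S_range[OF assms(1)] S_range[OF assms(2)] by (intro mod_pos_pos_trivial) auto
    finally show False
      using no_triple_sums_to_n[OF S_reflect[OF assms(1)] S_reflect[OF assms(2)] z] by auto
  qed
qed

section \<open>Completeness\<close>

lemma pair_to_sum:
  assumes "x \<in> S" "y \<in> S" "x + y + z = n" "0 \<le> z" "z < n"
  shows "\<exists>x\<in>S. \<exists>y\<in>S. z = (x + y) mod n"
proof -
  have "(n - x) + (n - y) = z + n" using assms(3) by simp
  then have "((n - x) + (n - y)) mod n = z mod n" by (simp only: mod_add_self2)
  then have "((n - x) + (n - y)) mod n = z" using assms(4,5) by simp
  then show ?thesis using S_reflect[OF assms(1)] S_reflect[OF assms(2)] by metis
qed

text \<open>At the lower end, the mirrored condition in \<open>mid\<close> holds because \<open>N + N\<close> is bounded by \<open>8h\<close>.\<close>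
lemma midI:
  assumes "m + 2 * h \<le> y" "y \<le> m + 30 * h" "y - m - r \<notin> pair_sums"
  shows "y \<in> mid"
  using assms pair_sums_bounds[of "n - y - m - r"] r_bounds scale
  unfolding mid_def n_def by auto

text \<open>
  Let \<open>b = 4h - r - 1\<close>. A partner for a residue \<open>z\<close> near \<open>m\<close> is chosen by its position. Below
  \<open>m - b\<close>, the partner \<open>m - b\<close> leaves a third summand beyond all forbidden residues. Strictly
  between \<open>m\<close> and \<open>m + 2h\<close> it leaves one before all of them, which is still at least \<open>m + 2h\<close>
  because \<open>b - (2h - 1) + r = 2h\<close>. From \<open>m - b\<close> to \<open>m\<close>, the partner \<open>m - 2h\<close> works by the gap
  property. From \<open>m + 2h\<close> on, only forbidden residues are missing.
\<close>
lemma complete_lower_half: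
  assumes "0 \<le> z" "2 * z \<le> n" "z \<notin> S"
  shows "\<exists>x\<in>S. \<exists>y\<in>S. z = (x + y) mod n"
proof -
  have zn: "z < n" using assms r_bounds scale unfolding n_def by linarith
  let ?b = "4 * h - r - 1"
  have via: ?thesis if "y \<in> low" "m + q \<in> mid" "y + (m + q) + z = n" for y q
    using pair_to_sum[of y "m + q" z] that assms(1) zn unfolding S_def by auto
  consider "z \<le> m - 16 * h" | "m - 16 * h < z" "z < m - ?b" | "m - ?b \<le> z" "z \<le> m"
    | "m < z" "z < m + 2 * h" | "m + 2 * h \<le> z" by linarith
  then show ?thesis
  proof cases
    case 1
    \<comment> \<open>No forbidden residue lies in this stretch, so its differences fill an interval.\<close>
    have *: "y \<in> mid" if "m + 8 * h \<le> y" "y \<le> n - m - 8 * h" for y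
      using that pair_sums_bounds[of "y - m - r"] pair_sums_bounds[of "n - y - m - r"]
        r_bounds scale unfolding mid_def by auto
    have "m + 8 * h \<in> mid" "m + 8 * h + z \<in> mid"
      using 1 assms(1) r_bounds scale by (intro *; simp add: n_def)+
    then have "m + 8 * h \<in> S" "n - (m + 8 * h + z) \<in> S"
      using mid_reflect unfolding S_def by blast+
    then show ?thesis using pair_to_sum[of "m + 8 * h" "n - (m + 8 * h + z)" z] assms(1) zn by auto
  next
    case 2
    \<comment> \<open>\<open>m - z > b\<close>, so this shift exceeds the largest pair sum \<open>2b\<close>.\<close>
    have "m + (m - z + ?b + r) \<in> mid"
      using 2 pair_sums_bounds(2)[of "m + (m - z + ?b + r) - m - r"] r_bounds scale
      by (intro midI) linarith+
    then show ?thesis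
      by (rule via[OF lowI[OF top]]) (simp add: n_def)
  next
    case 3
    have "m - z \<notin> N" using assms(3) lowI[of "m - z"] unfolding S_def by auto
    then have "m - z + 2 * h \<notin> pair_sums"
      using bottom_shift_pair_sums[of "m - z"] 3 by auto
    then have "m + (m - z + 2 * h + r) \<in> mid"
      using 3 r_bounds scale by (intro midI) (auto simp: algebra_simps)
    then show ?thesis
      by (rule via[OF lowI[OF bottom]]) (simp add: n_def)
  next
    case 4
    \<comment> \<open>Here the shift stays below the smallest pair sum \<open>4h\<close>.\<close>
    have "m + (?b - (z - m) + r) \<in> mid"
      using 4 pair_sums_bounds(1)[of "m + (?b - (z - m) + r) - m - r"] r_bounds scale
      by (intro midI) linarith+
    then show ?thesis
      by (rule via[OF lowI[OF top]]) (simp add: n_def)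
  next
    case 5
    have "z \<notin> mid" using assms(3) unfolding S_def by auto
    then have "z - m - r \<in> pair_sums"
      using 5 assms(2) pair_sums_bounds[of "n - z - m - r"] r_bounds scale
      unfolding mid_def n_def by auto
    then obtain k l where "k \<in> N" "l \<in> N" "z - m - r = k + l"
      unfolding pair_sums_def by auto
    then show ?thesis
      using pair_to_sum[of "m - k" "m - l" z] lowI assms(1) zn unfolding S_def n_def by auto
  qed
qed

lemma complete:
  assumes "0 \<le> z" "z < n" "z \<notin> S"
  shows "\<exists>x\<in>S. \<exists>y\<in>S. z = (x + y) mod n"
proof (cases "2 * z \<le> n")
  case True
  then show ?thesis using complete_lower_half assms by auto
next
  case False
  have "n - z \<notin> S" using S_reflect[of "n - z"] assms(3) by auto
  then obtain x y where xy: "x \<in> S" "y \<in> S" "n - z = (x + y) mod n"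
    using complete_lower_half[of "n - z"] False assms by auto
  have "((n - x) + (n - y)) mod n = (- (x + y)) mod n"
    by (metis (no_types, opaque_lifting) add.commute diff_add_eq diff_diff_eq2 diff_minus_eq_add
        minus_add_distrib mod_add_self1 mod_add_self2 uminus_add_conv_diff)
  also have "\<dots> = (- (n - z)) mod n" by (simp add: xy(3) mod_minus_eq)
  also have "\<dots> = z" using assms by simp
  finally show ?thesis using S_reflect[OF xy(1)] S_reflect[OF xy(2)] by metis
qed

section \<open>Counting\<close>

lemma mem_S_iff_profile:
  assumes "0 \<le> k"
  shows "m - k \<in> S \<longleftrightarrow> k \<in> N"
proof
  assume "m - k \<in> S"
  moreover have "m - k \<notin> mid" using assms scale unfolding mid_def by auto
  moreover have "n - (m - k) \<notin> low"
    using low_bounds[of "n - (m - k)"] assms r_bounds scale unfolding n_def by auto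
  ultimately have "m - k \<in> low" unfolding S_def by auto
  then show "k \<in> N" unfolding low_def by auto
next
  assume "k \<in> N"
  then show "m - k \<in> S" using lowI unfolding S_def by auto
qed

lemma complete_sum_free_in_group:
  defines "G \<equiv> integer_mod_group (nat n)"
  shows "S \<subseteq> carrier G" "symmetric_set G S" "complete_set G S" "sum_free_set G S"
proof -
  have pos: "0 < n" using r_bounds scale unfolding n_def by linarith
  have carr: "carrier G = {0..<n}"
    using pos unfolding G_def by (simp add: carrier_integer_mod_group)
  have sums: "S <#>\<^bsub>G\<^esub> S = {(x + y) mod n | x y. x \<in> S \<and> y \<in> S}"
    using pos unfolding G_def set_mult_def by auto
  show "S \<subseteq> carrier G" using S_range unfolding carr by force
  show "symmetric_set G S"
    unfolding symmetric_set_def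
  proof
    fix x assume x: "x \<in> S"
    have "inv\<^bsub>G\<^esub> x = (- x) mod n"
      using S_range[OF x] pos unfolding G_def by (simp add: carrier_integer_mod_group)
    also have "\<dots> = (n - x) mod n" by simp
    also have "\<dots> = n - x" using S_range[OF x] by (intro mod_pos_pos_trivial) auto
    finally show "inv\<^bsub>G\<^esub> x \<in> S" using S_reflect[OF x] by simp
  qed
  show "complete_set G S" using complete unfolding complete_set_def carr sums by fastforce
  show "sum_free_set G S" using sum_free unfolding sum_free_set_def sums by auto
qed

end

text \<open>
  The free part of \<open>N\<close> ranges over \<open>{3h..4h - 4}\<close>; the upper bound keeps it below the fixed greatest
  element \<open>4h - r - 1\<close> for each of the three values of \<open>r\<close>.
\<close>
lemma exponentially_many:
  fixes m r h :: int
  assumes "0 \<le> r" "r \<le> 2" "3 \<le> h" "100 * h \<le> m"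
  defines "G \<equiv> integer_mod_group (nat (3 * m + r))"
  shows "2 ^ nat (h - 3) \<le>
    card {S. S \<subseteq> carrier G \<and> symmetric_set G S \<and> complete_set G S \<and> sum_free_set G S}"
    (is "_ \<le> card ?F")
proof -
  define J where "J = {3 * h..4 * h - 4}"
  define prof where "prof = (\<lambda>X. X \<union> {2 * h, 4 * h - r - 1})"
  define F where "F = (\<lambda>X. profile.S m r h (prof X))"
  have loc: "profile m r h (prof X)" if "X \<in> Pow J" for X
    using that assms(1-4) unfolding J_def prof_def by unfold_locales auto
  have rec: "X = {k \<in> J. m - k \<in> F X}" if "X \<in> Pow J" for X
  proof -
    have "m - k \<in> F X \<longleftrightarrow> k \<in> X" if "k \<in> J" for k
      using profile.mem_S_iff_profile[OF loc[OF \<open>X \<in> Pow J\<close>], of k] that assms(1-4)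
      unfolding F_def J_def prof_def by auto
    then show ?thesis using that by auto
  qed
  have inj: "inj_on F (Pow J)"
    by (rule inj_onI) (metis rec)
  have "F ` Pow J \<subseteq> ?F"
    using profile.complete_sum_free_in_group[OF loc] profile.n_def[OF loc]
    unfolding F_def G_def by auto
  moreover have "finite ?F"
  proof (rule finite_subset)
    show "?F \<subseteq> Pow (carrier G)" by auto
    show "finite (Pow (carrier G))"
      using assms(1-4) unfolding G_def by (simp add: carrier_integer_mod_group)
  qed
  ultimately have "card (Pow J) \<le> card ?F"
    using card_mono card_image[OF inj] by metis
  moreover have "card (Pow J) = 2 ^ nat (h - 3)"
    unfolding J_def by (simp add: card_Pow)
  ultimately show ?thesis by simp
qed

theorem theorem1p3:
  shows "\<exists>c::real. c > 0 \<and> (\<exists>N::nat. \<forall>n\<ge>N.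
    2 powr (c * real n) \<le>
      real (card {S. S \<subseteq> carrier (integer_mod_group n) \<and>
                     symmetric_set (integer_mod_group n) S \<and>
                     complete_set (integer_mod_group n) S \<and>
                     sum_free_set (integer_mod_group n) S}))"
proof (intro exI[of _ "1/1000"] exI[of _ 3000] conjI allI impI)
  fix n :: nat
  assume n: "3000 \<le> n"
  let ?c = "card {S. S \<subseteq> carrier (integer_mod_group n) \<and>
                     symmetric_set (integer_mod_group n) S \<and>
                     complete_set (integer_mod_group n) S \<and>
                     sum_free_set (integer_mod_group n) S}"
  define m where "m = int n div 3"
  define r where "r = int n mod 3"
  define h where "h = m div 100"
  have n_eq: "int n = 3 * m + r" unfolding m_def r_def by simp
  have r: "0 \<le> r" "r \<le> 2" unfolding r_def by auto
  have h: "3 \<le> h" "100 * h \<le> m" "m < 100 * h + 100"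
    using n unfolding h_def m_def by linarith+
  have "2 ^ nat (h - 3) \<le> ?c"
    using exponentially_many[OF r h(1,2)] n_eq by (metis nat_int)
  then have card: "2 ^ nat (h - 3) \<le> real ?c"
    by (metis of_nat_le_iff of_nat_numeral of_nat_power)
  \<comment> \<open>As \<open>h\<close> is about \<open>n/300\<close>, the rate \<open>1/1000\<close> leaves room for the \<open>-3\<close> and for rounding.\<close>
  have "3000 \<le> 3 * m + r" using n n_eq by linarith
  then have "3 * m + r \<le> 1000 * h - 3000" using h r by linarith
  then have "int n \<le> 1000 * h - 3000" using n_eq by simp
  then have "real n \<le> 1000 * real (nat (h - 3))" using h by linarith
  then have "2 powr (1 / 1000 * real n) \<le> 2 powr real (nat (h - 3))"
    by (intro powr_mono) auto
  also have "\<dots> = 2 ^ nat (h - 3)" by (simp add: powr_realpow)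
  also have "\<dots> \<le> real ?c" by (rule card)
  finally show "2 powr (1 / 1000 * real n) \<le> real ?c" .
qed simp

end
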